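(* Let $k\in\mathbb{N}$, let $(X,f_{1,\infty})$ be a $k$-periodic non-autonomous discrete system and let $g=f_k\circ f_{k-1}\circ\cdots\circ f_1$. If $(X,f_{1,\infty})$ is cofinitely sensitive, then the autonomous discrete system $(X,g)$ is cofinitely sensitive. Conversely, if each $f_p$ $(p=1,2,\dots,k)$ is uniformly continuous and $(X,g)$ is cofinitely sensitive, then $(X,f_{1,\infty})$ is cofinitely sensitive.
   Context: $\mathbb{N}=\{1,2,3,\dots\}$, $\mathbb{Z}_+=\{0,1,2,\dots\}$. A non-autonomous discrete system (NDS) $(X,f_{1,\infty})$ consists of a metric space $(X,d)$ and a sequence $f_{1,\infty}=(f_n)_{n=1}^\infty$ of continuous maps $f_n:X\to X$. For $i,n\in\mathbb{N}$, $f_i^n:=f_{i+n-1}\circ\cdots\circ f_i$. The NDS is $k$-periodic if $f_{n+k}=f_n$ for all $n\in\mathbb{N}$. An autonomous system $(X,g)$ is the special case $f_n=g$ for all $n$ (so $f_1^n$ is the $n$-th iterate $g^n$). For a non-empty open set $U\subseteq X$ and $\delta>0$, $N_{f_{1,\infty}}(U,\delta)=\{n\in\mathbb{N}:\text{there exist }x,y\in U\text{ with }d(f_1^n(x),f_1^n(y))>\delta\}$. Cofinite: $A\subseteq\mathbb{Z}_+$ is cofinite if there is $N\in\mathbb{Z}_+$ such that $A$ contains all integers $n\ge N$. Cofinitely sensitive: there is $\delta>0$ such that $N_{f_{1,\infty}}(U,\delta)$ is cofinite for every non-empty open set $U\subseteq X$. *)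

theory Defs
  imports "HOL-Analysis.Analysis"
begin

text \<open>
  The metric space is a type of class \<open>metric_space\<close>. Sequences of maps are indexed by the
  positive integers: the value \<open>f 0\<close> is a dummy that is never constrained or used.
\<close>

definition nds :: "(nat \<Rightarrow> 'a::metric_space \<Rightarrow> 'a) \<Rightarrow> bool" where
  "nds f \<longleftrightarrow> (\<forall>n\<ge>1. continuous_on UNIV (f n))"

text \<open>\<open>nds_comp f i n = f (i + n - 1) \<circ> \<dots> \<circ> f i\<close>\<close>

primrec nds_comp :: "(nat \<Rightarrow> 'a \<Rightarrow> 'a) \<Rightarrow> nat \<Rightarrow> nat \<Rightarrow> 'a \<Rightarrow> 'a" where
  "nds_comp f i 0 = id"
| "nds_comp f i (Suc n) = f (i + n) \<circ> nds_comp f i n"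

definition periodic_nds :: "nat \<Rightarrow> (nat \<Rightarrow> 'a::metric_space \<Rightarrow> 'a) \<Rightarrow> bool" where
  "periodic_nds k f \<longleftrightarrow> nds f \<and> (\<forall>n\<ge>1. f (n + k) = f n)"

definition autonomous :: "('a \<Rightarrow> 'a) \<Rightarrow> nat \<Rightarrow> 'a \<Rightarrow> 'a" where
  "autonomous g = (\<lambda>n. g)"

definition sens_times :: "(nat \<Rightarrow> 'a::metric_space \<Rightarrow> 'a) \<Rightarrow> 'a set \<Rightarrow> real \<Rightarrow> nat set" where
  "sens_times f U \<delta> =
     {n. 1 \<le> n \<and> (\<exists>x\<in>U. \<exists>y\<in>U. dist (nds_comp f 1 n x) (nds_comp f 1 n y) > \<delta>)}"

definition cofinite_set :: "nat set \<Rightarrow> bool" where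
  "cofinite_set A \<longleftrightarrow> (\<exists>N. \<forall>n\<ge>N. n \<in> A)"

definition cofinitely_sensitive :: "(nat \<Rightarrow> 'a::metric_space \<Rightarrow> 'a) \<Rightarrow> bool" where
  "cofinitely_sensitive f \<longleftrightarrow>
     (\<exists>\<delta>>0. \<forall>U. open U \<and> U \<noteq> {} \<longrightarrow> cofinite_set (sens_times f U \<delta>))"

end

theory Submission
  imports Defs
begin

text \<open>
  Along multiples of \<open>k\<close> the orbits of \<open>f\<close> are those of \<open>g\<close>, which gives the first implication.
  For the converse, write \<open>n = q * k + s\<close> with \<open>s < k\<close>: the iterate \<open>g ^ (q + 1)\<close> is the
  \<open>n\<close>-fold composition of \<open>f\<close> followed by a map depending only on \<open>s\<close>. These \<open>k\<close> maps
  are uniformly equicontinuous, so a pair of points separated by \<open>g ^ (q + 1)\<close> was already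
  separated, by a uniform amount, at time \<open>n\<close>.
\<close>

lemma nds_comp_add:
  "nds_comp f i (m + n) = nds_comp f (i + m) n \<circ> nds_comp f i m"
  by (induction n) (auto simp: add.assoc)

lemma periodic_nds_add_mult:
  assumes "periodic_nds k f" "n \<ge> 1"
  shows "f (n + q * k) = f n"
proof (induction q)
  case (Suc q)
  have "f ((n + q * k) + k) = f (n + q * k)"
    using assms by (simp add: periodic_nds_def)
  with Suc show ?case by (simp add: ac_simps)
qed simp

lemma nds_comp_periodic:
  assumes "periodic_nds k f" "i \<ge> 1"
  shows "nds_comp f (i + q * k) n = nds_comp f i n"
proof (induction n)
  case (Suc n)
  have "f (i + q * k + n) = f (i + n)"
    using periodic_nds_add_mult[OF assms(1), of "i + n" q] assms(2) by (simp add: ac_simps)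
  with Suc show ?case by simp
qed simp

text \<open>Each further application of \<open>g\<close> appends a block of \<open>k\<close> maps
  starting at index \<open>1 + m * k\<close>; by periodicity this block is the first one,
  \<open>f k \<circ> ... \<circ> f 1\<close>.\<close>

lemma nds_comp_autonomous_eq:
  assumes "periodic_nds k f"
  shows "nds_comp (autonomous (nds_comp f 1 k)) 1 m = nds_comp f 1 (m * k)"
proof (induction m)
  case (Suc m)
  have "nds_comp f 1 (Suc m * k) = nds_comp f (1 + m * k) k \<circ> nds_comp f 1 (m * k)"
    using nds_comp_add[of f 1 "m * k" k] by (simp add: add.commute)
  with Suc show ?case
    using nds_comp_periodic[OF assms, of 1 m k] by (simp add: autonomous_def)
qed simp

lemma uniformly_continuous_nds_comp:
  fixes f :: "nat \<Rightarrow> 'a::metric_space \<Rightarrow> 'a"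
  assumes "\<And>p. p \<ge> i \<Longrightarrow> uniformly_continuous_on UNIV (f p)"
  shows "uniformly_continuous_on UNIV (nds_comp f i n)"
proof (induction n)
  case 0
  show ?case by (simp add: id_def uniformly_continuous_on_id)
next
  case (Suc n)
  have "uniformly_continuous_on (range (nds_comp f i n)) (f (i + n))"
    using assms[OF le_add1] unfolding uniformly_continuous_on_def by blast
  from uniformly_continuous_on_compose[OF Suc this] show ?case
    by (simp add: comp_def)
qed

text \<open>The minimum of finitely many moduli of continuity serves all maps at once. It must not
  depend on the points, since it is applied along whole orbits.\<close>

lemma finite_uniformly_equicontinuous:
  fixes h :: "'i \<Rightarrow> 'a::metric_space \<Rightarrow> 'b::metric_space"
  assumes "finite S" "\<And>s. s \<in> S \<Longrightarrow> uniformly_continuous_on UNIV (h s)" "e > 0"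
  shows "\<exists>d>0. \<forall>s\<in>S. \<forall>u v. dist u v < d \<longrightarrow> dist (h s u) (h s v) < e"
  using assms(1,2)
proof (induction S rule: finite_induct)
  case empty
  show ?case by (auto intro: exI[of _ 1])
next
  case (insert s S)
  have "\<exists>d>0. \<forall>t\<in>S. \<forall>u v. dist u v < d \<longrightarrow> dist (h t u) (h t v) < e"
    by (rule insert.IH) (rule insert.prems, erule insertI2)
  then obtain d where "d > 0" and d: "\<forall>t\<in>S. \<forall>u v. dist u v < d \<longrightarrow> dist (h t u) (h t v) < e"
    by blast
  have "uniformly_continuous_on UNIV (h s)"
    by (rule insert.prems) (rule insertI1)
  then obtain d' where "d' > 0" and d': "\<forall>u v. dist u v < d' \<longrightarrow> dist (h s u) (h s v) < e"
    unfolding isUCont_def using \<open>e > 0\<close> by meson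
  from \<open>d > 0\<close> \<open>d' > 0\<close> d d' show ?case
    by (intro exI[of _ "min d d'"]) simp
qed

lemma cofinitely_sensitive_imp_autonomous:
  assumes "k \<ge> 1" "periodic_nds k f" "cofinitely_sensitive f"
  shows "cofinitely_sensitive (autonomous (nds_comp f 1 k))"
proof -
  obtain \<delta> where "\<delta> > 0"
    and \<delta>: "\<And>U. open U \<Longrightarrow> U \<noteq> {} \<Longrightarrow> cofinite_set (sens_times f U \<delta>)"
    using assms(3) unfolding cofinitely_sensitive_def by blast
  have "cofinite_set (sens_times (autonomous (nds_comp f 1 k)) U \<delta>)" if "open U" "U \<noteq> {}" for U
  proof -
    obtain N where N: "\<And>n. n \<ge> N \<Longrightarrow> n \<in> sens_times f U \<delta>"
      using \<delta> \<open>open U\<close> \<open>U \<noteq> {}\<close> unfolding cofinite_set_def by blast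
    \<comment> \<open>As \<open>m * k \<ge> m\<close>, the threshold for \<open>f\<close> also works
      for \<open>g\<close>; \<open>Suc\<close> only ensures that \<open>m\<close> is positive, as
      \<open>sens_times\<close> requires.\<close>
    have "m \<in> sens_times (autonomous (nds_comp f 1 k)) U \<delta>" if "m \<ge> Suc N" for m
    proof -
      have "m * 1 \<le> m * k"
        using assms(1) by (intro mult_le_mono2)
      with that have "m * k \<in> sens_times f U \<delta>"
        by (intro N) linarith
      with that show ?thesis
        unfolding sens_times_def nds_comp_autonomous_eq[OF assms(2)] by simp
    qed
    then show ?thesis unfolding cofinite_set_def by blast
  qed
  with \<open>\<delta> > 0\<close> show ?thesis unfolding cofinitely_sensitive_def by blast
qed

lemma cofinitely_sensitive_if_autonomous:
  assumes "k \<ge> 1" "periodic_nds k f"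
    and unif: "\<forall>p\<in>{1..k}. uniformly_continuous_on UNIV (f p)"
    and "cofinitely_sensitive (autonomous (nds_comp f 1 k))"
  shows "cofinitely_sensitive f"
proof -
  let ?g = "autonomous (nds_comp f 1 k)"
  obtain \<delta> where "\<delta> > 0"
    and \<delta>: "\<And>U. open U \<Longrightarrow> U \<noteq> {} \<Longrightarrow> cofinite_set (sens_times ?g U \<delta>)"
    using assms(4) unfolding cofinitely_sensitive_def by blast
  have unif_all: "uniformly_continuous_on UNIV (f p)" if "p \<ge> 1" for p
  proof -
    \<comment> \<open>The representative of \<open>p\<close> modulo \<open>k\<close> in
      \<open>{1..k}\<close>; indices start at 1, hence the shift before and after
      \<open>mod\<close>.\<close>
    define r where "r = Suc ((p - 1) mod k)"
    have "r \<in> {1..k}"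
      using assms(1) by (simp add: r_def Suc_le_eq)
    moreover have "r + (p - 1) div k * k = p"
      using that by (simp add: r_def)
    then have "f p = f r"
      using periodic_nds_add_mult[OF assms(2), of r "(p - 1) div k"] by (simp add: r_def)
    ultimately show ?thesis using unif by simp
  qed
  \<comment> \<open>\<open>h s\<close> is the rest of a period after its first \<open>s\<close>
    maps, namely \<open>f k \<circ> ... \<circ> f (s + 1)\<close>; in particular \<open>h 0\<close>
    is \<open>g\<close>.\<close>
  define h where "h = (\<lambda>s. nds_comp f (1 + s) (k - s))"
  have "uniformly_continuous_on UNIV (h s)" for s
    unfolding h_def by (rule uniformly_continuous_nds_comp) (simp add: unif_all)
  then have "\<exists>d>0. \<forall>s\<in>{..<k}. \<forall>u v. dist u v < d \<longrightarrow> dist (h s u) (h s v) < \<delta>"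
    using \<open>\<delta> > 0\<close> by (intro finite_uniformly_equicontinuous finite_lessThan)
  then obtain d where "d > 0"
    and d: "\<And>s u v. s < k \<Longrightarrow> dist u v < d \<Longrightarrow> dist (h s u) (h s v) < \<delta>"
    unfolding Ball_def lessThan_iff by blast
  \<comment> \<open>Time \<open>n\<close> is completed to the next multiple of \<open>k\<close>,
    strictly beyond \<open>n\<close>: if \<open>k\<close> divides \<open>n\<close>, a full period is
    added.\<close>
  have factor: "nds_comp ?g 1 (Suc (n div k)) = h (n mod k) \<circ> nds_comp f 1 n" for n
  proof -
    have "n mod k < k"
      using assms(1) by simp
    then have "Suc (n div k) * k = n + (k - n mod k)"
      using div_mult_mod_eq[of n k] unfolding mult_Suc by linarith
    moreover have "nds_comp f (1 + n) (k - n mod k) = h (n mod k)"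
      using nds_comp_periodic[OF assms(2), of "1 + n mod k" "n div k"] by (simp add: h_def)
    ultimately show ?thesis
      by (simp only: nds_comp_autonomous_eq[OF assms(2)] nds_comp_add)
  qed
  \<comment> \<open>Equicontinuity yields only separation \<open>\<ge> d\<close>, while
    \<open>sens_times\<close> asks for a strict inequality; hence \<open>d / 2\<close>.\<close>
  have "cofinite_set (sens_times f U (d / 2))" if "open U" "U \<noteq> {}" for U
  proof -
    obtain N where N: "\<And>m. m \<ge> N \<Longrightarrow> m \<in> sens_times ?g U \<delta>"
      using \<delta> \<open>open U\<close> \<open>U \<noteq> {}\<close> unfolding cofinite_set_def by blast
    have "n \<in> sens_times f U (d / 2)" if "n \<ge> Suc (N * k)" for n
    proof -
      have "N \<le> n div k"
        using that assms(1) by (simp add: less_eq_div_iff_mult_less_eq)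
      then obtain x y where xy: "x \<in> U" "y \<in> U"
        and sep: "dist (h (n mod k) (nds_comp f 1 n x)) (h (n mod k) (nds_comp f 1 n y)) > \<delta>"
        using N[of "Suc (n div k)"] unfolding sens_times_def mem_Collect_eq factor by auto
      have "n mod k < k"
        using assms(1) by simp
      \<comment> \<open>Points closer than \<open>d\<close> would be mapped by
        \<open>h (n mod k)\<close> to points closer than \<open>\<delta>\<close>, against
        \<open>sep\<close>.\<close>
      then have "dist (nds_comp f 1 n x) (nds_comp f 1 n y) \<ge> d"
        using d sep by (meson less_asym not_le)
      with \<open>d > 0\<close> have "dist (nds_comp f 1 n x) (nds_comp f 1 n y) > d / 2"
        by linarith
      with xy that show ?thesis
        unfolding sens_times_def by auto
    qed
    then show ?thesis unfolding cofinite_set_def by blast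
  qed
  with \<open>d > 0\<close> show ?thesis
    unfolding cofinitely_sensitive_def by (intro exI[of _ "d / 2"]) simp
qed

theorem theorem11:
  fixes f :: "nat \<Rightarrow> 'a::metric_space \<Rightarrow> 'a" and g :: "'a \<Rightarrow> 'a" and k :: nat
  assumes "k \<ge> 1"
    and "periodic_nds k f"
    and "g = nds_comp f 1 k"
  shows "(cofinitely_sensitive f \<longrightarrow> cofinitely_sensitive (autonomous g)) \<and>
    ((\<forall>p\<in>{1..k}. uniformly_continuous_on UNIV (f p)) \<and> cofinitely_sensitive (autonomous g)
       \<longrightarrow> cofinitely_sensitive f)"
  using cofinitely_sensitive_imp_autonomous[OF assms(1,2)]
    cofinitely_sensitive_if_autonomous[OF assms(1,2)] assms(3) by blast

end
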